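(* Let $X$ be a metric space and let $\mathcal{M}\subseteq\mathcal{B}(\ell_2(X))$ be a $*$-subalgebra closed in the weak operator topology and containing a unit $1_{\mathcal{M}}$. Suppose there is an increasing sequence $(p_n)_n$ of central projections in $\mathcal{M}$ that converges to $1_{\mathcal{M}}$ in the strong operator topology and such that each $p_n\mathcal{M}p_n$ is finite-dimensional. (1) If $\mathcal{M}\subseteq\mathrm{C}^*_{ql}(X)$, then the unit ball of $\mathcal{M}$ is equi-quasi-local. (2) If $\mathcal{M}\subseteq\mathrm{C}^*_u(X)$, then the unit ball of $\mathcal{M}$ is equi-approximable.
   Context: $X$ is an arbitrary metric space. The unit $1_{\mathcal{M}}$ of $\mathcal{M}$ need not be the identity of $\mathcal{B}(\ell_2(X))$. $\ell_2(X)$ is the complex Hilbert space of square-summable functions on $X$ with orthonormal basis $(\delta_x)_{x\in X}$; for $A\subseteq X$, $\chi_A$ is the orthogonal projection onto $\ell_2(A)$; $d(A,B)=\inf\{d(x,y): x\in A, y\in B\}$. The propagation of $a\in\mathcal{B}(\ell_2(X))$ is $\mathrm{prop}(a)=\sup\{d(x,z): \langle a\delta_x,\delta_z\rangle\ne 0\}$. The uniform Roe algebra $\mathrm{C}^*_u(X)$ is the norm closure of the $*$-algebra of operators in $\mathcal{B}(\ell_2(X))$ of finite propagation. For $\varepsilon,r>0$, $a$ is $\varepsilon$-$r$-quasi-local if $\|\chi_Aa\chi_B\|\le\varepsilon$ for all $A,B\subseteq X$ with $d(A,B)>r$; $a$ is $\varepsilon$-$r$-approximable if there is $b\in\mathcal{B}(\ell_2(X))$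 with $\mathrm{prop}(b)\le r$ and $\|a-b\|\le\varepsilon$. The quasi-local algebra $\mathrm{C}^*_{ql}(X)$ consists of all $a\in\mathcal{B}(\ell_2(X))$ such that for every $\varepsilon>0$ there is $r>0$ for which $a$ is $\varepsilon$-$r$-quasi-local. A set $S\subseteq\mathcal{B}(\ell_2(X))$ is equi-quasi-local (respectively equi-approximable) if for all $\varepsilon>0$ there is $r>0$ such that every contraction $a\in S$ is $\varepsilon$-$r$-quasi-local (respectively $\varepsilon$-$r$-approximable). *)

theory Defs
  imports "HOL-Analysis.Analysis"
begin

section \<open>The Hilbert space of square-summable functions\<close>

typedef 'a ell2 = "{f :: 'a \<Rightarrow> complex. (\<lambda>x. (cmod (f x))\<^sup>2) summable_on UNIV}"
  morphisms ell2_apply Abs_ell2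
  by (rule exI[of _ "\<lambda>_. 0"]) simp

setup_lifting type_definition_ell2

lemma ell2_summable: "(\<lambda>x. (cmod (ell2_apply f x))\<^sup>2) summable_on A"
  by (rule summable_on_subset_banach[of _ UNIV]) (use ell2_apply[of f] in auto)

lemma sq_summable_add:
  fixes f g :: "'a \<Rightarrow> complex"
  assumes "(\<lambda>x. (cmod (f x))\<^sup>2) summable_on UNIV" "(\<lambda>x. (cmod (g x))\<^sup>2) summable_on UNIV"
  shows "(\<lambda>x. (cmod (f x + g x))\<^sup>2) summable_on UNIV"
proof (rule summable_on_comparison_test)
  show "(\<lambda>x. 2 * (cmod (f x))\<^sup>2 + 2 * (cmod (g x))\<^sup>2) summable_on UNIV"
    by (intro summable_on_add summable_on_cmult_right assms)
  fix x
  have "(cmod (f x + g x))\<^sup>2 \<le> (cmod (f x) + cmod (g x))\<^sup>2"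
    by (intro power_mono norm_triangle_ineq) simp
  also have "\<dots> \<le> 2 * (cmod (f x))\<^sup>2 + 2 * (cmod (g x))\<^sup>2"
    using sum_squares_bound[of "cmod (f x)" "cmod (g x)"] by (simp add: power2_sum)
  finally show "(cmod (f x + g x))\<^sup>2 \<le> 2 * (cmod (f x))\<^sup>2 + 2 * (cmod (g x))\<^sup>2" .
qed simp

lift_definition scaleC :: "complex \<Rightarrow> 'a ell2 \<Rightarrow> 'a ell2" (infixr \<open>*\<^sub>C\<close> 75)
  is "\<lambda>c f x. c * f x"
  by (auto simp: norm_mult power_mult_distrib intro: summable_on_cmult_right)

text \<open>The inner product is linear in the first argument.\<close>

definition cinner :: "'a ell2 \<Rightarrow> 'a ell2 \<Rightarrow> complex" where
  "cinner f g = (\<Sum>\<^sub>\<infinity>x. ell2_apply f x * cnj (ell2_apply g x))"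

lemma cinner_summable: "(\<lambda>x. ell2_apply f x * cnj (ell2_apply g x)) summable_on A"
proof -
  have "(\<lambda>x. norm (ell2_apply f x * cnj (ell2_apply g x))) summable_on A"
    by (rule Infinite_Sum.abs_summable_product)
      (use ell2_summable[of f A] ell2_summable[of g A] in
        \<open>simp_all only: norm_mult complex_mod_cnj power2_eq_square\<close>)
  then show ?thesis
    by (rule Infinite_Sum.abs_summable_summable)
qed

instantiation ell2 :: (type) real_vector
begin
lift_definition zero_ell2 :: "'a ell2" is "\<lambda>_. 0" by simp
lift_definition plus_ell2 :: "'a ell2 \<Rightarrow> 'a ell2 \<Rightarrow> 'a ell2" is "\<lambda>f g x. f x + g x"
  by (auto intro: sq_summable_add)
lift_definition uminus_ell2 :: "'a ell2 \<Rightarrow> 'a ell2" is "\<lambda>f x. - f x" by simp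
definition minus_ell2 :: "'a ell2 \<Rightarrow> 'a ell2 \<Rightarrow> 'a ell2" where "minus_ell2 f g = f + - g"
definition scaleR_ell2 :: "real \<Rightarrow> 'a ell2 \<Rightarrow> 'a ell2" where
  "scaleR_ell2 r f = complex_of_real r *\<^sub>C f"
instance
  by standard
    (unfold minus_ell2_def scaleR_ell2_def, (transfer; auto simp: algebra_simps fun_eq_iff)+)
end

lemma ell2_eqI: "(\<And>x. ell2_apply f x = ell2_apply g x) \<Longrightarrow> f = g"
  by (metis ell2_apply_inverse ext)

lemma ell2_apply_simps [simp]:
  "ell2_apply 0 x = 0"
  "ell2_apply (f + g) x = ell2_apply f x + ell2_apply g x"
  "ell2_apply (- f) x = - ell2_apply f x"
  "ell2_apply (f - g) x = ell2_apply f x - ell2_apply g x"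
  "ell2_apply (c *\<^sub>C f) x = c * ell2_apply f x"
  "ell2_apply (r *\<^sub>R f) x = complex_of_real r * ell2_apply f x"
  unfolding minus_ell2_def scaleR_ell2_def by (transfer, simp)+

lemma ell2_apply_sum: "ell2_apply (sum f F) x = (\<Sum>i\<in>F. ell2_apply (f i) x)"
  by (induction F rule: infinite_finite_induct) auto

lemma cinner_add_left: "cinner (f + g) h = cinner f h + cinner g h"
  unfolding cinner_def by (simp add: distrib_right infsum_add cinner_summable)

lemma cinner_scaleC_left: "cinner (c *\<^sub>C f) h = c * cinner f h"
  unfolding cinner_def by (simp add: mult.assoc infsum_cmult_right')

lemma cinner_commute: "cinner f g = cnj (cinner g f)"
  unfolding cinner_def by (simp flip: infsum_cnj add: mult.commute)

lemma cinner_self: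
  "cinner f f = complex_of_real (\<Sum>\<^sub>\<infinity>x. (cmod (ell2_apply f x))\<^sup>2)"
proof -
  have "cinner f f = (\<Sum>\<^sub>\<infinity>x. complex_of_real ((cmod (ell2_apply f x))\<^sup>2))"
    unfolding cinner_def by (simp only: complex_norm_square)
  then show ?thesis
    using infsumI[OF has_sum_bounded_linear[OF bounded_linear_of_real has_sum_infsum, OF ell2_summable]]
    by (simp add: o_def)
qed

instantiation ell2 :: (type) real_inner
begin
definition inner_ell2 :: "'a ell2 \<Rightarrow> 'a ell2 \<Rightarrow> real" where "inner_ell2 f g = Re (cinner f g)"
definition norm_ell2 :: "'a ell2 \<Rightarrow> real" where
  "norm_ell2 f = sqrt (\<Sum>\<^sub>\<infinity>x. (cmod (ell2_apply f x))\<^sup>2)"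
definition sgn_ell2 :: "'a ell2 \<Rightarrow> 'a ell2" where "sgn_ell2 f = f /\<^sub>R norm f"
definition dist_ell2 :: "'a ell2 \<Rightarrow> 'a ell2 \<Rightarrow> real" where "dist_ell2 f g = norm (f - g)"
definition uniformity_ell2 :: "('a ell2 \<times> 'a ell2) filter" where
  "uniformity_ell2 = (INF e\<in>{0 <..}. principal {(x, y). dist x y < e})"
definition open_ell2 :: "'a ell2 set \<Rightarrow> bool" where
  "open_ell2 U \<longleftrightarrow> (\<forall>x\<in>U. eventually (\<lambda>(x', y). x' = x \<longrightarrow> y \<in> U) uniformity)"
instance
proof
  fix f g h :: "'a ell2" and r :: real
  show "inner f g = inner g f"
    unfolding inner_ell2_def by (subst cinner_commute) simp
  show "inner (f + g) h = inner f h + inner g h"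
    by (simp add: inner_ell2_def cinner_add_left)
  show "inner (r *\<^sub>R f) g = r * inner f g"
    by (simp add: inner_ell2_def scaleR_ell2_def cinner_scaleC_left)
  show "0 \<le> inner f f"
    by (simp add: inner_ell2_def cinner_self infsum_nonneg)
  show "inner f f = 0 \<longleftrightarrow> f = 0"
  proof
    assume "inner f f = 0"
    then have *: "(\<Sum>\<^sub>\<infinity>x. (cmod (ell2_apply f x))\<^sup>2) \<le> 0"
      by (simp add: inner_ell2_def cinner_self)
    have "(cmod (ell2_apply f x))\<^sup>2 = 0" for x
      by (rule nonneg_infsum_le_0D[OF * ell2_summable]) auto
    then show "f = 0"
      by (intro ell2_eqI) simp
  qed (simp add: inner_ell2_def cinner_def)
  show "norm f = sqrt (inner f f)"
    by (simp add: norm_ell2_def inner_ell2_def cinner_self)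
qed (auto simp: sgn_ell2_def dist_ell2_def uniformity_ell2_def open_ell2_def)
end

lift_definition delta :: "'a \<Rightarrow> 'a ell2" is "\<lambda>x y. if y = x then 1 else 0"
proof -
  fix x :: 'a
  show "(\<lambda>y. (cmod (if y = x then 1 else 0))\<^sup>2) summable_on UNIV"
    by (subst summable_on_cong_neutral[of "{x}" UNIV]) auto
qed

lift_definition restrict_ell2 :: "'a set \<Rightarrow> 'a ell2 \<Rightarrow> 'a ell2" is
  "\<lambda>A f x. if x \<in> A then f x else 0"
  by (erule summable_on_comparison_test) auto

lifting_forget ell2.lifting


section \<open>Bounded operators\<close>

text \<open>\<open>'a ell2 \<Rightarrow>\<^sub>L 'a ell2\<close> is the space of bounded \<^emph>\<open>real\<close>-linear operators with the operator
  norm; the bounded complex-linear operators are carved out by the following set.\<close>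

type_synonym 'a op = "'a ell2 \<Rightarrow>\<^sub>L 'a ell2"

definition bounded_ops :: "'a op set" where
  "bounded_ops = {a. \<forall>c v. blinfun_apply a (c *\<^sub>C v) = c *\<^sub>C blinfun_apply a v}"

lemma norm_scaleC: "norm (c *\<^sub>C f) = cmod c * norm f"
  by (simp add: norm_ell2_def norm_mult power_mult_distrib infsum_cmult_right' real_sqrt_mult)

lemma bounded_linear_scaleC: "bounded_linear (\<lambda>v. c *\<^sub>C v)"
  by (rule bounded_linear_intro[of _ "cmod c"])
    (auto intro!: ell2_eqI simp: norm_scaleC algebra_simps)

lift_definition scaleC_op :: "complex \<Rightarrow> 'a op \<Rightarrow> 'a op" is "\<lambda>c a v. c *\<^sub>C a v"
  by (rule bounded_linear_compose[OF bounded_linear_scaleC])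

interpretation cop: vector_space scaleC_op
  by standard (auto intro!: blinfun_eqI ell2_eqI
      simp: scaleC_op.rep_eq blinfun.add_left algebra_simps)

definition fin_dim :: "'a op set \<Rightarrow> bool" where
  "fin_dim S \<longleftrightarrow> cop.subspace S \<and> (\<exists>B. finite B \<and> cop.span B = S)"

definition adj :: "'a op \<Rightarrow> 'a op" where
  "adj a = (THE b. \<forall>v w. cinner (blinfun_apply a v) w = cinner v (blinfun_apply b w))"

lift_definition chi :: "'a set \<Rightarrow> 'a op" is restrict_ell2
proof -
  fix A :: "'a set"
  show "bounded_linear (restrict_ell2 A)"
  proof (rule bounded_linear_intro[of _ 1])
    fix v :: "'a ell2"
    have "(\<lambda>x. (cmod (if x \<in> A then ell2_apply v x else 0))\<^sup>2) summable_on UNIV"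
      using ell2_summable[of "restrict_ell2 A v" UNIV] by (simp add: restrict_ell2.rep_eq)
    then show "norm (restrict_ell2 A v) \<le> norm v * 1"
      unfolding norm_ell2_def restrict_ell2.rep_eq mult_1_right
      by (intro real_sqrt_le_mono infsum_mono ell2_summable) auto
  qed (auto intro!: ell2_eqI simp: restrict_ell2.rep_eq)
qed

lemma chi_apply: "ell2_apply (blinfun_apply (chi A) v) x = (if x \<in> A then ell2_apply v x else 0)"
  by (simp add: chi.rep_eq restrict_ell2.rep_eq)

definition positive_op :: "'a op \<Rightarrow> bool" where
  "positive_op a \<longleftrightarrow> (\<forall>v. cinner (blinfun_apply a v) v \<in> \<real>\<^sub>\<ge>\<^sub>0)"

definition op_le :: "'a op \<Rightarrow> 'a op \<Rightarrow> bool" where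
  "op_le a b \<longleftrightarrow> positive_op (b - a)"

definition projection :: "'a op \<Rightarrow> bool" where
  "projection p \<longleftrightarrow> p \<in> bounded_ops \<and> p o\<^sub>L p = p \<and> adj p = p"

definition star_subalgebra :: "'a op set \<Rightarrow> bool" where
  "star_subalgebra M \<longleftrightarrow> M \<subseteq> bounded_ops \<and> cop.subspace M
     \<and> (\<forall>a\<in>M. \<forall>b\<in>M. a o\<^sub>L b \<in> M) \<and> (\<forall>a\<in>M. adj a \<in> M)"

definition is_unit_of :: "'a op \<Rightarrow> 'a op set \<Rightarrow> bool" where
  "is_unit_of e M \<longleftrightarrow> e \<in> M \<and> (\<forall>a\<in>M. e o\<^sub>L a = a \<and> a o\<^sub>L e = a)"

definition central_projection :: "'a op \<Rightarrow> 'a op set \<Rightarrow> bool" where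
  "central_projection p M \<longleftrightarrow> p \<in> M \<and> projection p \<and> (\<forall>a\<in>M. p o\<^sub>L a = a o\<^sub>L p)"

text \<open>Both topologies are initial topologies; \<open>euclidean\<close> on a function space is the topology of
  pointwise convergence (with respect to the modulus on the complex numbers, respectively the
  norm on \<open>'a ell2\<close>).\<close>

definition wot :: "'a op topology" where
  "wot = pullback_topology bounded_ops (\<lambda>a (v, w). cinner (blinfun_apply a v) w) euclidean"

definition sot :: "'a op topology" where
  "sot = pullback_topology bounded_ops blinfun_apply euclidean"


section \<open>Well-definedness of the adjoint\<close>

lemma cinner_bounded: "cmod (cinner f g) \<le> norm f * norm g"
proof (cases "cinner f g = 0")
  case False
  define c where "c = cnj (cinner f g) / cmod (cinner f g)"
  have c: "cmod c = 1"
    using False by (simp add: c_def norm_divide)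
  have "c * cinner f g = cmod (cinner f g)"
    using False complex_norm_square[of "cinner f g"]
    by (simp add: c_def field_simps power2_eq_square)
  then have "cmod (cinner f g) = inner (c *\<^sub>C f) g"
    by (simp add: inner_ell2_def cinner_scaleC_left)
  also have "\<dots> \<le> norm (c *\<^sub>C f) * norm g"
    by (rule norm_cauchy_schwarz)
  finally show ?thesis
    by (simp add: norm_scaleC c)
qed simp

lemma bounded_linear_cinner_left: "bounded_linear (\<lambda>f. cinner f g)"
  by (rule bounded_linear_intro[of _ "norm g"])
    (auto simp: cinner_add_left cinner_scaleC_left scaleR_ell2_def scaleR_conv_of_real cinner_bounded)

lemma cinner_delta_right: "cinner f (delta x) = ell2_apply f x"
proof -
  have "cinner f (delta x) = (\<Sum>\<^sub>\<infinity>y\<in>{x}. ell2_apply f y)"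
    unfolding cinner_def delta.rep_eq by (rule infsum_cong_neutral) auto
  then show ?thesis by simp
qed

lemma delta_has_sum: "((\<lambda>x. ell2_apply f x *\<^sub>C delta x) has_sum f) UNIV"
proof -
  let ?s = "\<lambda>x. (cmod (ell2_apply f x))\<^sup>2"
  have fin: "sum (\<lambda>x. ell2_apply f x *\<^sub>C delta x) F = blinfun_apply (chi F) f" if "finite F" for F
    by (rule ell2_eqI)
      (use that in \<open>simp add: ell2_apply_sum chi_apply delta.rep_eq if_distrib[of "(*) _"] cong: if_cong\<close>)
  have nrm: "dist (sum (\<lambda>x. ell2_apply f x *\<^sub>C delta x) F) f = sqrt ((\<Sum>\<^sub>\<infinity>x. ?s x) - sum ?s F)"
    if F: "finite F" for F
  proof -
    have "(norm (f - blinfun_apply (chi F) f))\<^sup>2 = (\<Sum>\<^sub>\<infinity>x. (cmod (ell2_apply (f - blinfun_apply (chi F) f) x))\<^sup>2)"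
      by (simp add: norm_ell2_def infsum_nonneg)
    also have "\<dots> = infsum ?s (- F)"
      by (rule infsum_cong_neutral) (auto simp: chi_apply)
    also have "infsum ?s UNIV = infsum ?s F + infsum ?s (- F)"
      using infsum_Un_disjoint[of ?s F "- F"] ell2_summable[of f] by (simp add: Compl_partition)
    then have "infsum ?s (- F) = infsum ?s UNIV - sum ?s F"
      using F by simp
    finally show ?thesis
      by (simp add: fin F dist_norm norm_minus_commute real_sqrt_unique)
  qed
  have "((\<lambda>F. sqrt ((\<Sum>\<^sub>\<infinity>x. ?s x) - sum ?s F)) \<longlongrightarrow> sqrt ((\<Sum>\<^sub>\<infinity>x. ?s x) - (\<Sum>\<^sub>\<infinity>x. ?s x))) (finite_subsets_at_top UNIV)"
    by (intro tendsto_intros infsum_tendsto ell2_summable)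
  moreover have "\<forall>\<^sub>F F in finite_subsets_at_top UNIV. sqrt ((\<Sum>\<^sub>\<infinity>x. ?s x) - sum ?s F)
      = dist (sum (\<lambda>x. ell2_apply f x *\<^sub>C delta x) F) f"
    by (rule eventually_finite_subsets_at_top_weakI) (simp add: nrm)
  ultimately have "((\<lambda>F. dist (sum (\<lambda>x. ell2_apply f x *\<^sub>C delta x) F) f) \<longlongrightarrow> 0) (finite_subsets_at_top UNIV)"
    using Lim_transform_eventually by force
  then show ?thesis
    unfolding has_sum_def by (rule tendsto_dist_iff[THEN iffD2])
qed

lemma adj_exists:
  assumes a: "a \<in> bounded_ops"
  shows "\<exists>b. \<forall>v w. cinner (blinfun_apply a v) w = cinner v (blinfun_apply b w)"
proof -
  have bl: "bounded_linear (\<lambda>v. cinner (blinfun_apply a v) w)" for w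
    using bounded_linear_compose[OF bounded_linear_cinner_left blinfun.bounded_linear_right] .
  define g where "g = (\<lambda>w x. cnj (cinner (blinfun_apply a (delta x)) w))"
  have bound: "(\<Sum>x\<in>F. (cmod (g w x))\<^sup>2) \<le> (norm a * norm w)\<^sup>2" if F: "finite F" for F w
  proof -
    let ?S = "\<Sum>x\<in>F. (cmod (g w x))\<^sup>2"
    define v where "v = (\<Sum>x\<in>F. g w x *\<^sub>C delta x)"
    have v: "ell2_apply v x = (if x \<in> F then g w x else 0)" for x
      using F by (simp add: v_def ell2_apply_sum delta.rep_eq if_distrib[of "(*) _"] cong: if_cong)
    have nv: "(norm v)\<^sup>2 = ?S"
    proof -
      have "(norm v)\<^sup>2 = (\<Sum>\<^sub>\<infinity>x. (cmod (ell2_apply v x))\<^sup>2)"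
        by (simp add: norm_ell2_def infsum_nonneg)
      also have "\<dots> = (\<Sum>\<^sub>\<infinity>x\<in>F. (cmod (g w x))\<^sup>2)"
        by (rule infsum_cong_neutral) (auto simp: v)
      finally show ?thesis using F by simp
    qed
    have "cinner (blinfun_apply a v) w = (\<Sum>x\<in>F. g w x * cinner (blinfun_apply a (delta x)) w)"
      unfolding v_def linear_sum[OF bounded_linear.linear[OF bl]]
      using a by (simp add: bounded_ops_def cinner_scaleC_left)
    also have "\<dots> = complex_of_real ?S"
      unfolding of_real_sum by (rule sum.cong) (simp_all only: complex_norm_square g_def complex_cnj_cnj)
    finally have "?S = cmod (cinner (blinfun_apply a v) w)"
      by (simp only: norm_of_real) (simp add: sum_nonneg)
    also have "\<dots> \<le> norm (blinfun_apply a v) * norm w"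
      by (rule cinner_bounded)
    also have "\<dots> \<le> (norm a * norm w) * norm v"
      using mult_right_mono[OF norm_blinfun[of a v], of "norm w"] by (simp add: mult_ac)
    finally have *: "(norm v)\<^sup>2 \<le> (norm a * norm w) * norm v"
      by (simp add: nv)
    have "norm v \<le> norm a * norm w"
      using * by (cases "norm v = 0") (auto simp: power2_eq_square)
    then show ?thesis
      unfolding nv[symmetric] by (intro power_mono) auto
  qed
  have sm: "(\<lambda>x. (cmod (g w x))\<^sup>2) summable_on UNIV" for w
    by (rule nonneg_bdd_above_summable_on) (use bound in \<open>auto intro!: bdd_aboveI2\<close>)
  have ap: "ell2_apply (Abs_ell2 (g w)) = g w" for w
    by (rule Abs_ell2_inverse) (use sm in simp)
  have g_add: "g (w + w') x = g w x + g w' x" and g_scale: "g (r *\<^sub>R w) x = r * g w x" for w w' x r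
    using cinner_commute[of _ "blinfun_apply a (delta x)"]
    by (simp_all add: g_def cinner_add_left cinner_scaleC_left scaleR_ell2_def flip: cinner_commute)
  have "bounded_linear (\<lambda>w. Abs_ell2 (g w))"
  proof (rule bounded_linear_intro[of _ "norm a"])
    fix w
    have "(\<Sum>\<^sub>\<infinity>x. (cmod (g w x))\<^sup>2) \<le> (norm a * norm w)\<^sup>2"
      by (rule infsum_le_finite_sums[OF sm]) (use bound in auto)
    then show "norm (Abs_ell2 (g w)) \<le> norm w * norm a"
      unfolding norm_ell2_def[of "Abs_ell2 _"] ap by (intro real_le_lsqrt) (auto simp: mult.commute infsum_nonneg)
  qed (auto intro!: ell2_eqI simp: ap g_add g_scale)
  then have b: "blinfun_apply (Blinfun (\<lambda>w. Abs_ell2 (g w))) = (\<lambda>w. Abs_ell2 (g w))"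
    by (rule bounded_linear_Blinfun_apply)
  have "cinner (blinfun_apply a v) w = cinner v (Abs_ell2 (g w))" for v w
  proof -
    have "((\<lambda>x. cinner (blinfun_apply a (ell2_apply v x *\<^sub>C delta x)) w) has_sum cinner (blinfun_apply a v) w) UNIV"
      by (rule has_sum_bounded_linear[OF bl delta_has_sum, unfolded o_def])
    then have "((\<lambda>x. ell2_apply v x * cnj (g w x)) has_sum cinner (blinfun_apply a v) w) UNIV"
      using a by (simp add: bounded_ops_def cinner_scaleC_left g_def)
    then show ?thesis
      unfolding cinner_def[of v] ap by (simp add: infsumI)
  qed
  then show ?thesis
    by (intro exI[of _ "Blinfun (\<lambda>w. Abs_ell2 (g w))"]) (simp add: b)
qed

lemma adj_works:
  assumes "a \<in> bounded_ops"
  shows "cinner (blinfun_apply a v) w = cinner v (blinfun_apply (adj a) w)"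
proof -
  have "\<exists>!b. \<forall>v w. cinner (blinfun_apply a v) w = cinner v (blinfun_apply b w)"
  proof (rule ex_ex1I[OF adj_exists[OF assms]])
    fix b c
    assume *: "\<forall>v w. cinner (blinfun_apply a v) w = cinner v (blinfun_apply b w)"
      "\<forall>v w. cinner (blinfun_apply a v) w = cinner v (blinfun_apply c w)"
    have "cinner (blinfun_apply b w) (delta x) = cinner (blinfun_apply c w) (delta x)" for w x
      using * cinner_commute by metis
    then show "b = c"
      by (intro blinfun_eqI ell2_eqI) (simp add: cinner_delta_right)
  qed
  from theI'[OF this] show ?thesis
    unfolding adj_def by blast
qed


section \<open>Uniform Roe algebra and quasi-local algebra\<close>

text \<open>The supremum is taken in \<open>[0, \<infinity>]\<close>, so that the zero operator has propagation \<open>0\<close>.\<close>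

definition propagation :: "'a::metric_space op \<Rightarrow> ennreal" where
  "propagation a =
     Sup {ennreal (dist x z) |x z. cinner (blinfun_apply a (delta x)) (delta z) \<noteq> 0}"

definition uniform_roe :: "'a::metric_space op set" where
  "uniform_roe = closure {a \<in> bounded_ops. propagation a < \<infinity>}"

text \<open>\<open>setdist A B\<close> is \<open>0\<close> rather than \<open>\<infinity>\<close> if \<open>A\<close> or \<open>B\<close> is empty; this is immaterial
  because \<open>chi {} = 0\<close>.\<close>

definition quasi_local :: "real \<Rightarrow> real \<Rightarrow> 'a::metric_space op \<Rightarrow> bool" where
  "quasi_local \<epsilon> r a \<longleftrightarrow> (\<forall>A B. setdist A B > r \<longrightarrow> norm (chi A o\<^sub>L a o\<^sub>L chi B) \<le> \<epsilon>)"

definition approximable :: "real \<Rightarrow> real \<Rightarrow> 'a::metric_space op \<Rightarrow> bool" where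
  "approximable \<epsilon> r a \<longleftrightarrow>
     (\<exists>b\<in>bounded_ops. propagation b \<le> ennreal r \<and> norm (a - b) \<le> \<epsilon>)"

definition quasi_local_algebra :: "'a::metric_space op set" where
  "quasi_local_algebra = {a \<in> bounded_ops. \<forall>\<epsilon>>0. \<exists>r>0. quasi_local \<epsilon> r a}"

definition equi_quasi_local :: "'a::metric_space op set \<Rightarrow> bool" where
  "equi_quasi_local S \<longleftrightarrow> (\<forall>\<epsilon>>0. \<exists>r>0. \<forall>a\<in>S. norm a \<le> 1 \<longrightarrow> quasi_local \<epsilon> r a)"

definition equi_approximable :: "'a::metric_space op set \<Rightarrow> bool" where
  "equi_approximable S \<longleftrightarrow> (\<forall>\<epsilon>>0. \<exists>r>0. \<forall>a\<in>S. norm a \<le> 1 \<longrightarrow> approximable \<epsilon> r a)"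

end

theory Submission
  imports Defs
begin

text \<open>Both properties (quasi-local and approximable with given \<open>\<epsilon>\<close> and \<open>r\<close>) define subsets of the
  unit ball that are closed in the weak operator topology; for approximability this uses weak
  operator compactness to pass to a limit of the approximants. If \<open>M\<close> lies in the relevant algebra,
  its unit ball is the union over \<open>r\<close> of these closed sets, so by a Baire category argument some
  \<open>r\<close> works for all elements \<open>b\<close> of the unit ball with \<open>b p\<^sub>n = a\<^sub>0 p\<^sub>n\<close>, for suitable \<open>n\<close> and \<open>a\<^sub>0\<close>.
  For an arbitrary \<open>a\<close> in the unit ball, \<open>b = a\<^sub>0 p\<^sub>n + a (1 - p\<^sub>n)\<close> is such an element since \<open>p\<^sub>n\<close>
  is central, and \<open>a = b - a\<^sub>0 p\<^sub>n + p\<^sub>n a p\<^sub>n\<close>, where \<open>a\<^sub>0 p\<^sub>n\<close> is fixed and \<open>p\<^sub>n a p\<^sub>n\<close> ranges over the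
  norm-compact unit ball of the finite-dimensional corner.\<close>

section \<open>Weak operator compactness\<close>

lemma cinner_add_right: "cinner f (g + h) = cinner f g + cinner f h"
  by (subst (1 2 3) cinner_commute) (simp add: cinner_add_left)

lemma cinner_scaleC_right: "cinner f (c *\<^sub>C g) = cnj c * cinner f g"
  by (subst (1 2) cinner_commute) (simp add: cinner_scaleC_left)

lemma cinner_diff_left: "cinner (f - g) h = cinner f h - cinner g h"
  using cinner_add_left[of "f - g" g h] by simp

lemma cmod_cinner_self: "cmod (cinner f f) = (norm f)\<^sup>2"
  by (simp add: cinner_self norm_ell2_def infsum_nonneg)

text \<open>Riesz representation for sesquilinear forms: the coordinate of the image of
  \<open>v\<close> at \<open>x\<close> can only be \<open>B v (delta x)\<close>, and the bound on
  the form makes these coordinates square-summable. It turns a pointwise limit of forms back into an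
  operator.\<close>

lemma bounded_form_op:
  fixes B :: "'a ell2 \<Rightarrow> 'a ell2 \<Rightarrow> complex"
  assumes addl: "\<And>u v w. B (u + v) w = B u w + B v w"
    and scalel: "\<And>c v w. B (c *\<^sub>C v) w = c * B v w"
    and addr: "\<And>u v w. B u (v + w) = B u v + B u w"
    and scaler: "\<And>c v w. B v (c *\<^sub>C w) = cnj c * B v w"
    and bound: "\<And>v w. cmod (B v w) \<le> C * norm v * norm w"
  obtains b where "b \<in> bounded_ops" "\<And>v w. cinner (blinfun_apply b v) w = B v w"
proof -
  define g where "g = (\<lambda>v x. B v (delta x))"
  have blr: "bounded_linear (B v)" for v
    by (rule bounded_linear_intro[of _ "C * norm v"])
      (use bound[of v] in \<open>auto simp: addr scaler scaleR_ell2_def scaleR_conv_of_real mult_ac\<close>)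
  \<comment> \<open>The sign of \<open>C\<close> is not assumed; the bound at \<open>w = v\<close>
    forces it for nonzero \<open>v\<close>.\<close>
  have C_norm: "0 \<le> C * norm v" for v :: "'a ell2"
    using order_trans[OF norm_ge_zero bound[of v v]]
    by (cases "v = 0") (auto simp: zero_le_mult_iff)
  have fin_bound: "(\<Sum>x\<in>F. (cmod (g v x))\<^sup>2) \<le> (C * norm v)\<^sup>2" if F: "finite F" for F v
  proof -
    let ?S = "\<Sum>x\<in>F. (cmod (g v x))\<^sup>2"
    \<comment> \<open>\<open>w\<close> is the truncation to \<open>F\<close> of the intended image
      of \<open>v\<close>, so that \<open>B v w\<close> equals the squared norm of \<open>w\<close>.
      Cancelling one factor \<open>norm w\<close> in the bound leaves an estimate independent of
      \<open>F\<close>.\<close>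
    define w where "w = (\<Sum>x\<in>F. g v x *\<^sub>C delta x)"
    have w: "ell2_apply w x = (if x \<in> F then g v x else 0)" for x
      using F by (simp add: w_def ell2_apply_sum delta.rep_eq if_distrib[of "(*) _"] cong: if_cong)
    have nw: "(norm w)\<^sup>2 = ?S"
    proof -
      have "(norm w)\<^sup>2 = (\<Sum>\<^sub>\<infinity>x. (cmod (ell2_apply w x))\<^sup>2)"
        by (simp add: norm_ell2_def infsum_nonneg)
      also have "\<dots> = (\<Sum>\<^sub>\<infinity>x\<in>F. (cmod (g v x))\<^sup>2)"
        by (rule infsum_cong_neutral) (auto simp: w)
      finally show ?thesis using F by simp
    qed
    have "B v w = (\<Sum>x\<in>F. cnj (g v x) * B v (delta x))"
      unfolding w_def linear_sum[OF bounded_linear.linear[OF blr]] by (simp add: scaler)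
    also have "\<dots> = complex_of_real ?S"
      unfolding of_real_sum
      by (rule sum.cong) (simp_all only: complex_norm_square g_def mult.commute)
    finally have "?S = cmod (B v w)"
      by (simp only: norm_of_real) (simp add: sum_nonneg)
    also have "\<dots> \<le> C * norm v * norm w"
      by (rule bound)
    finally have *: "(norm w)\<^sup>2 \<le> (C * norm v) * norm w"
      by (simp add: nw)
    have "norm w \<le> C * norm v"
      using * C_norm[of v] by (cases "norm w = 0") (auto simp: power2_eq_square)
    then show ?thesis
      unfolding nw[symmetric] by (intro power_mono) auto
  qed
  have sm: "(\<lambda>x. (cmod (g v x))\<^sup>2) summable_on UNIV" for v
    by (rule nonneg_bdd_above_summable_on) (use fin_bound in \<open>auto intro!: bdd_aboveI2\<close>)
  have ap: "ell2_apply (Abs_ell2 (g v)) = g v" for v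
    by (rule Abs_ell2_inverse) (use sm in simp)
  have g_add: "g (u + v) x = g u x + g v x" and g_scaleC: "g (c *\<^sub>C v) x = c * g v x" for u v c x
    by (simp_all add: g_def addl scalel)
  have "bounded_linear (\<lambda>v. Abs_ell2 (g v))"
  proof (rule bounded_linear_intro[of _ C])
    fix v
    have "(\<Sum>\<^sub>\<infinity>x. (cmod (g v x))\<^sup>2) \<le> (C * norm v)\<^sup>2"
      by (rule infsum_le_finite_sums[OF sm]) (use fin_bound in auto)
    then show "norm (Abs_ell2 (g v)) \<le> norm v * C"
      unfolding norm_ell2_def[of "Abs_ell2 _"] ap using C_norm[of v]
      by (intro real_le_lsqrt) (auto simp: mult.commute infsum_nonneg)
  qed (auto intro!: ell2_eqI simp: ap g_add g_scaleC scaleR_ell2_def)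
  then have b: "blinfun_apply (Blinfun (\<lambda>v. Abs_ell2 (g v))) = (\<lambda>v. Abs_ell2 (g v))"
    by (rule bounded_linear_Blinfun_apply)
  show ?thesis
  proof (rule that)
    show "Blinfun (\<lambda>v. Abs_ell2 (g v)) \<in> bounded_ops"
      by (auto intro!: ell2_eqI simp: bounded_ops_def b ap g_scaleC)
    fix v w
    have "((\<lambda>x. B v (ell2_apply w x *\<^sub>C delta x)) has_sum B v w) UNIV"
      by (rule has_sum_bounded_linear[OF blr delta_has_sum, unfolded o_def])
    then have "((\<lambda>x. g v x * cnj (ell2_apply w x)) has_sum B v w) UNIV"
      by (simp add: scaler g_def mult.commute)
    then show "cinner (blinfun_apply (Blinfun (\<lambda>v. Abs_ell2 (g v))) v) w = B v w"
      unfolding cinner_def[of _ w] ap b by (simp add: infsumI)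
  qed
qed

text \<open>General filters are allowed because compactness below yields convergence only along a
  finer filter.\<close>

definition wot_tendsto :: "('i \<Rightarrow> 'a op) \<Rightarrow> 'a op \<Rightarrow> 'i filter \<Rightarrow> bool" where
  "wot_tendsto a l F \<longleftrightarrow>
     (\<forall>v w. ((\<lambda>i. cinner (blinfun_apply (a i) v) w) \<longlongrightarrow> cinner (blinfun_apply l v) w) F)"

lemma wot_tendstoD:
  "wot_tendsto a l F \<Longrightarrow> ((\<lambda>i. cinner (blinfun_apply (a i) v) w) \<longlongrightarrow> cinner (blinfun_apply l v) w) F"
  by (simp add: wot_tendsto_def)

lemma wot_tendsto_mono: "wot_tendsto a l F \<Longrightarrow> G \<le> F \<Longrightarrow> wot_tendsto a l G"
  unfolding wot_tendsto_def using tendsto_mono by blast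

lemma wot_tendsto_diff:
  "wot_tendsto a l F \<Longrightarrow> wot_tendsto b m F \<Longrightarrow> wot_tendsto (\<lambda>i. a i - b i) (l - m) F"
  unfolding wot_tendsto_def blinfun.diff_left cinner_diff_left
  by (auto intro: tendsto_diff)

text \<open>Weak lower semicontinuity of the norm: test the convergence at \<open>v\<close> against
  the vector \<open>l v\<close> itself and cancel one factor of its norm.\<close>

lemma norm_le_wot_limit:
  assumes lim: "wot_tendsto a l F" and F: "F \<noteq> bot" and le: "\<forall>\<^sub>F i in F. norm (a i) \<le> C"
  shows "norm l \<le> C"
proof (rule norm_blinfun_bound)
  obtain i where "norm (a i) \<le> C"
    using eventually_happens[OF le] F by auto
  then show C: "0 \<le> C"
    using norm_ge_zero order_trans by blast
  fix v
  let ?lv = "blinfun_apply l v"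
  have "cmod (cinner ?lv ?lv) \<le> C * norm v * norm ?lv"
  proof (rule tendsto_upperbound[OF tendsto_norm[OF wot_tendstoD[OF lim]] _ F])
    show "\<forall>\<^sub>F i in F. cmod (cinner (blinfun_apply (a i) v) ?lv) \<le> C * norm v * norm ?lv"
      using le
    proof eventually_elim
      case (elim i)
      have "norm (blinfun_apply (a i) v) \<le> C * norm v"
        using norm_blinfun[of "a i" v] elim by (meson mult_right_mono norm_ge_zero order_trans)
      then show ?case
        using cinner_bounded[of "blinfun_apply (a i) v" ?lv] by (meson mult_right_mono norm_ge_zero order_trans)
    qed
  qed
  then show "norm ?lv \<le> C * norm v"
    using C by (cases "?lv = 0") (auto simp: cmod_cinner_self power2_eq_square)
qed

text \<open>Weak operator compactness of norm-bounded sets: Tychonoff's theorem applied to the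
  sesquilinear forms of the operators.\<close>

lemma wot_cluster_point:
  fixes b :: "'i \<Rightarrow> 'a op"
  assumes F: "F \<noteq> bot" and ops: "\<And>i. b i \<in> bounded_ops" and bd: "\<And>i. norm (b i) \<le> C"
  obtains G l where "G \<le> F" "G \<noteq> bot" "l \<in> bounded_ops" "wot_tendsto b l G"
proof -
  define \<Phi> where "\<Phi> = (\<lambda>i (v, w). cinner (blinfun_apply (b i) v) w)"
  define S :: "'a ell2 \<times> 'a ell2 \<Rightarrow> complex set" where "S = (\<lambda>(v, w). cball 0 (C * norm v * norm w))"
  have "compactin (product_topology (\<lambda>_. euclidean) UNIV) (PiE UNIV S)"
    unfolding compactin_PiE by (auto simp: S_def)
  then have "compact (PiE UNIV S)"
    by (simp add: euclidean_product_topology)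
  moreover have "\<Phi> i \<in> PiE UNIV S" for i
  proof -
    have "cmod (cinner (blinfun_apply (b i) v) w) \<le> C * norm v * norm w" for v w
    proof -
      have "norm (blinfun_apply (b i) v) \<le> C * norm v"
        using norm_blinfun[of "b i" v] bd[of i] by (meson mult_right_mono norm_ge_zero order_trans)
      then show ?thesis
        using cinner_bounded[of "blinfun_apply (b i) v" w] by (meson mult_right_mono norm_ge_zero order_trans)
    qed
    then show ?thesis by (auto simp: \<Phi>_def S_def)
  qed
  moreover have "filtermap \<Phi> F \<noteq> bot"
    using F by (simp add: filtermap_bot_iff)
  ultimately obtain \<phi> where \<phi>: "\<phi> \<in> PiE UNIV S" "inf (nhds \<phi>) (filtermap \<Phi> F) \<noteq> bot"
    unfolding compact_filter by (auto simp: eventually_filtermap)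
  \<comment> \<open>Pulling the neighbourhoods of the cluster point \<phi> back along \<Phi> refines
    \<open>F\<close> to a filter along which all forms converge. Over an arbitrary, possibly
    uncountable, index type a convergent subsequence need not exist.\<close>
  define G where "G = inf F (filtercomap \<Phi> (nhds \<phi>))"
  have GF: "G \<le> F" by (simp add: G_def)
  have "G \<noteq> bot"
  proof
    assume "G = bot"
    then obtain P Q where P: "eventually P F" and Q: "eventually Q (nhds \<phi>)"
      and PQ: "\<And>i. P i \<Longrightarrow> Q (\<Phi> i) \<Longrightarrow> False"
      unfolding G_def trivial_limit_def eventually_inf eventually_filtercomap by blast
    have "eventually (\<lambda>f. \<not> Q f) (filtermap \<Phi> F)"
      unfolding eventually_filtermap using P by eventually_elim (use PQ in blast)
    with Q have "eventually (\<lambda>_. False) (inf (nhds \<phi>) (filtermap \<Phi> F))"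
      unfolding eventually_inf by blast
    with \<phi>(2) show False by (simp add: trivial_limit_def)
  qed
  have lim\<Phi>: "filterlim \<Phi> (nhds \<phi>) G"
    by (rule filterlim_mono[OF filterlim_filtercomap order_refl]) (simp add: G_def)
  have lim: "((\<lambda>i. cinner (blinfun_apply (b i) v) w) \<longlongrightarrow> \<phi> (v, w)) G" for v w
    using lim\<Phi> continuous_on_tendsto_compose[OF continuous_on_product_coordinates[of "(v, w)"] lim\<Phi>]
    by (simp add: \<Phi>_def)
  note uniq = tendsto_unique[OF \<open>G \<noteq> bot\<close>]
  have bs: "blinfun_apply (b i) (c *\<^sub>C v) = c *\<^sub>C blinfun_apply (b i) v" for i c v
    using ops[of i] by (simp add: bounded_ops_def)
  obtain l where "l \<in> bounded_ops" "\<And>v w. cinner (blinfun_apply l v) w = \<phi> (v, w)"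
  proof (rule bounded_form_op[of "\<lambda>v w. \<phi> (v, w)" C])
    show "\<phi> (u + v, w) = \<phi> (u, w) + \<phi> (v, w)" for u v w
      using lim[of "u + v" w] tendsto_add[OF lim[of u w] lim[of v w]]
      by (intro uniq) (simp_all add: blinfun.add_right cinner_add_left)
    show "\<phi> (c *\<^sub>C v, w) = c * \<phi> (v, w)" for c v w
      using lim[of "c *\<^sub>C v" w] tendsto_mult_left[OF lim[of v w]]
      by (intro uniq) (simp_all add: bs cinner_scaleC_left)
    show "\<phi> (u, v + w) = \<phi> (u, v) + \<phi> (u, w)" for u v w
      using lim[of u "v + w"] tendsto_add[OF lim[of u v] lim[of u w]]
      by (intro uniq) (simp_all add: cinner_add_right)
    show "\<phi> (v, c *\<^sub>C w) = cnj c * \<phi> (v, w)" for c v w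
      using lim[of v "c *\<^sub>C w"] tendsto_mult_left[OF lim[of v w]]
      by (intro uniq) (simp_all add: cinner_scaleC_right)
    show "cmod (\<phi> (v, w)) \<le> C * norm v * norm w" for v w
      using \<phi>(1) by (auto simp: PiE_iff S_def)
  qed blast
  then show ?thesis
    using that[OF GF \<open>G \<noteq> bot\<close>] lim by (simp add: wot_tendsto_def)
qed

lemma closedin_wot_limit:
  assumes "closedin wot M" "wot_tendsto a l F" "F \<noteq> bot" "\<And>i. a i \<in> M" "l \<in> bounded_ops"
  shows "l \<in> M"
proof (rule ccontr)
  let ?f = "\<lambda>a (v, w). cinner (blinfun_apply a v) w"
  assume "l \<notin> M"
  have "openin wot (topspace wot - M)"
    using assms(1) by blast
  then obtain U where U: "open U" "topspace wot - M = ?f -` U \<inter> bounded_ops"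
    unfolding wot_def openin_pullback_topology by auto
  have top: "topspace wot = bounded_ops"
    by (simp add: wot_def topspace_pullback_topology)
  have "((\<lambda>i. ?f (a i)) \<longlongrightarrow> ?f l) F"
    using limitin_componentwise[of "\<lambda>_. euclidean" UNIV "\<lambda>i. ?f (a i)" "?f l" F] assms(2)
    by (auto simp: euclidean_product_topology wot_tendsto_def)
  moreover have "?f l \<in> U"
    using U(2) \<open>l \<notin> M\<close> assms(5) top by blast
  ultimately have "\<forall>\<^sub>F i in F. ?f (a i) \<in> U"
    using U(1) topological_tendstoD by blast
  then obtain i where "?f (a i) \<in> U"
    using eventually_happens assms(3) by blast
  moreover have "a i \<in> bounded_ops"
    using closedin_subset[OF assms(1)] assms(4) top by blast
  ultimately show False
    using U(2) assms(4) by blast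
qed

lemma limitin_sot_tendsto:
  fixes a :: "'i \<Rightarrow> 'a op"
  assumes "limitin sot a l F"
  shows "((\<lambda>i. blinfun_apply (a i) v) \<longlongrightarrow> blinfun_apply l v) F"
proof -
  have "continuous_map euclidean euclidean (\<lambda>f :: 'a ell2 \<Rightarrow> 'a ell2. f v)"
    by (auto intro: continuous_on_product_coordinates)
  from continuous_map_pullback[OF this, of bounded_ops blinfun_apply]
  have "continuous_map sot euclidean (\<lambda>a :: 'a op. blinfun_apply a v)"
    by (simp add: sot_def o_def)
  from continuous_map_limit[OF this assms] show ?thesis
    by (simp add: o_def)
qed

section \<open>Finite-dimensional spaces of operators and projections\<close>

lemma norm_contraction_compose_le:
  fixes a b c :: "'a op"
  assumes "norm a \<le> 1" "norm c \<le> 1"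
  shows "norm (a o\<^sub>L b o\<^sub>L c) \<le> norm b"
proof -
  have "norm (a o\<^sub>L b o\<^sub>L c) \<le> norm a * norm b * norm c"
    using norm_blinfun_compose[of "a o\<^sub>L b" c]
      mult_right_mono[OF norm_blinfun_compose[of a b], of "norm c"]
    by (meson norm_ge_zero order_trans)
  also have "\<dots> \<le> 1 * norm b * 1"
    using assms by (intro mult_mono) auto
  finally show ?thesis by simp
qed

lemma norm_scaleC_op: "norm (scaleC_op c a) = cmod c * norm a"
proof (rule antisym)
  have le: "norm (scaleC_op c a) \<le> cmod c * norm a" for c and a :: "'a op"
  proof (rule norm_blinfun_bound)
    fix v
    show "norm (blinfun_apply (scaleC_op c a) v) \<le> cmod c * norm a * norm v"
      using mult_left_mono[OF norm_blinfun[of a v], of "cmod c"]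
      by (simp add: scaleC_op.rep_eq norm_scaleC mult.assoc)
  qed simp
  then show "norm (scaleC_op c a) \<le> cmod c * norm a" .
  show "cmod c * norm a \<le> norm (scaleC_op c a)"
  proof (cases "c = 0")
    case False
    then have "norm a \<le> cmod (inverse c) * norm (scaleC_op c a)"
      using le[of "inverse c" "scaleC_op c a"] by simp
    then show ?thesis
      using False by (simp add: norm_divide field_simps)
  qed simp
qed

lemma continuous_on_scaleC_op: "continuous_on S (\<lambda>c. scaleC_op c a)"
proof -
  have "bounded_linear (\<lambda>c. scaleC_op c a)"
    by (rule bounded_linear_intro[of _ "norm a"])
      (auto intro!: blinfun_eqI ell2_eqI simp: norm_scaleC_op cop.scale_left_distrib scaleC_op.rep_eq
        blinfun.scaleR_left scaleR_conv_of_real mult.assoc)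
  then show ?thesis
    by (rule linear_continuous_on)
qed

text \<open>Heine-Borel for complex spans, by induction on the spanning set. A new vector outside
  the old span has positive distance to it, which bounds its coefficient, so the ball lies in a sum
  of two compact sets. The radius is generalized because the component in the old span may exceed
  \<open>r\<close>.\<close>

lemma compact_span_Int_cball:
  assumes "finite B"
  shows "compact (cop.span B \<inter> cball 0 r)"
  using assms
proof (induction B arbitrary: r)
  case empty
  then show ?case by (simp add: finite_imp_compact)
next
  case (insert b B)
  let ?W = "cop.span B"
  show ?case
  proof (cases "b \<in> ?W")
    case True
    then show ?thesis
      using insert.IH by (simp add: cop.span_redundant)
  next
    case False
    \<comment> \<open>A convergent sequence is bounded, hence stays in a ball of the span that is
      compact by induction.\<close>
    have "closed ?W"
      unfolding closed_sequential_limits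
    proof (intro allI impI, elim conjE)
      fix f l
      assume f: "\<forall>n. f n \<in> ?W" and lim: "f \<longlonglongrightarrow> l"
      obtain R where R: "\<And>n. norm (f n) \<le> R"
        using Bseq_def[of f] convergent_imp_Bseq[of f] lim convergentI by blast
      have "closed (?W \<inter> cball 0 R)"
        using insert.IH compact_imp_closed by blast
      then have "l \<in> ?W \<inter> cball 0 R"
        by (rule closed_sequentially) (use f R lim in auto)
      then show "l \<in> ?W" by simp
    qed
    define \<delta> where "\<delta> = infdist b ?W"
    have W0: "0 \<in> ?W" by (rule cop.span_zero)
    have \<delta>: "\<delta> > 0"
      using in_closed_iff_infdist_zero[OF \<open>closed ?W\<close>, of b] W0 False infdist_nonneg[of b ?W]
      unfolding \<delta>_def by fastforce
    define R where "R = r + (r / \<delta>) * norm b"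
    define K where "K = {x + y |x y. x \<in> ?W \<inter> cball 0 R \<and> y \<in> (\<lambda>c. scaleC_op c b) ` cball 0 (r / \<delta>)}"
    have "compact K"
      unfolding K_def
      by (intro compact_sums insert.IH compact_continuous_image continuous_on_scaleC_op compact_cball)
    moreover have "cop.span (insert b B) \<inter> cball 0 r = K \<inter> cball 0 r"
    proof (intro set_eqI iffI)
      fix a
      assume a: "a \<in> cop.span (insert b B) \<inter> cball 0 r"
      then obtain c where c: "a - scaleC_op c b \<in> ?W"
        using cop.span_breakdown_eq by blast
      \<comment> \<open>Write \<open>a = c b + w\<close> with \<open>w\<close> in the span. For
        nonzero \<open>c\<close>, the norm of \<open>a\<close> is \<open>cmod c\<close> times the
        distance from \<open>b\<close> to the element \<open>- w / c\<close> of the span, which is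
        at least \<delta>.\<close>
      have "cmod c * \<delta> \<le> norm a"
      proof (cases "c = 0")
        case False
        have "scaleC_op (- inverse c) (a - scaleC_op c b) \<in> ?W"
          using c by (rule cop.span_scale)
        from infdist_le[OF this, of b]
        have "\<delta> \<le> norm (b - scaleC_op (- inverse c) (a - scaleC_op c b))"
          by (simp add: \<delta>_def dist_norm)
        also have "b - scaleC_op (- inverse c) (a - scaleC_op c b) = scaleC_op (inverse c) a"
          using False by (simp add: cop.scale_right_diff_distrib)
        finally show ?thesis
          using False by (simp add: norm_scaleC_op norm_divide field_simps)
      qed simp
      then have c_le: "cmod c \<le> r / \<delta>"
        using a \<delta> by (simp add: field_simps)
      have "norm (a - scaleC_op c b) \<le> norm a + cmod c * norm b"
        using norm_triangle_ineq4[of a "scaleC_op c b"] by (simp add: norm_scaleC_op)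
      also have "\<dots> \<le> R"
        unfolding R_def using a c_le by (intro add_mono mult_right_mono) auto
      finally have "a - scaleC_op c b \<in> ?W \<inter> cball 0 R"
        using c by simp
      moreover have "scaleC_op c b \<in> (\<lambda>c. scaleC_op c b) ` cball 0 (r / \<delta>)"
        using c_le by (intro imageI) simp
      moreover have "a = (a - scaleC_op c b) + scaleC_op c b"
        by simp
      ultimately have "a \<in> K"
        unfolding K_def by blast
      then show "a \<in> K \<inter> cball 0 r"
        using a by simp
    next
      fix a
      assume "a \<in> K \<inter> cball 0 r"
      then show "a \<in> cop.span (insert b B) \<inter> cball 0 r"
        unfolding K_def
        by (auto intro!: cop.span_add cop.span_scale[OF cop.span_base]
            intro: subsetD[OF cop.span_mono[OF subset_insertI]])
    qed
    ultimately show ?thesis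
      by (simp add: compact_Int_closed)
  qed
qed

section \<open>Orthogonal projections and their order\<close>

lemma projection_idem: "projection p \<Longrightarrow> blinfun_apply p (blinfun_apply p v) = blinfun_apply p v"
  unfolding projection_def by (metis blinfun_apply_blinfun_compose)

lemma projection_inner_self:
  assumes "projection p"
  shows "inner (blinfun_apply p v) v = (norm (blinfun_apply p v))\<^sup>2"
  using adj_works[of p "blinfun_apply p v" v] projection_idem[OF assms, of v] assms
  by (simp add: projection_def inner_ell2_def power2_norm_eq_inner)

lemma projection_Pythagoras:
  assumes "projection p"
  shows "(norm v)\<^sup>2 = (norm (blinfun_apply p v))\<^sup>2 + (norm (v - blinfun_apply p v))\<^sup>2"
proof -
  let ?u = "blinfun_apply p v"
  have "inner ?u v = inner ?u ?u"
    by (simp add: projection_inner_self[OF assms] power2_norm_eq_inner)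
  then have "orthogonal ?u (v - ?u)"
    by (simp add: orthogonal_def inner_diff_right)
  from norm_add_Pythagorean[OF this] show ?thesis
    by simp
qed

lemma norm_projection_le_1:
  assumes "projection p"
  shows "norm p \<le> 1"
proof (rule norm_blinfun_bound)
  fix v
  have "(norm (blinfun_apply p v))\<^sup>2 \<le> (norm v)\<^sup>2"
    by (simp add: projection_Pythagoras[OF assms, of v])
  then show "norm (blinfun_apply p v) \<le> 1 * norm v"
    by (simp add: power2_le_iff_abs_le)
qed simp

text \<open>On a vector \<open>w\<close> killed by \<open>q\<close>, the form of
  \<open>q - p\<close> is minus the squared norm of \<open>p w\<close>, so positivity forces
  \<open>p w = 0\<close>. This applies to every \<open>v - q v\<close>.\<close>

lemma projection_op_le_imp_compose:
  assumes p: "projection p" and q: "projection q" and le: "op_le p q"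
  shows "p o\<^sub>L q = p"
proof (rule blinfun_eqI)
  fix v
  define w where "w = v - blinfun_apply q v"
  have qw: "blinfun_apply q w = 0"
    by (simp add: w_def blinfun.diff_right projection_idem[OF q])
  have "- (norm (blinfun_apply p w))\<^sup>2 = Re (cinner (blinfun_apply (q - p) w) w)"
    using qw projection_inner_self[OF p, of w]
    by (simp add: blinfun.diff_left inner_diff_left flip: inner_ell2_def)
  also have "\<dots> \<ge> 0"
    using le by (auto simp: op_le_def positive_op_def complex_nonneg_Reals_iff)
  finally have "blinfun_apply p w = 0"
    by simp
  then show "blinfun_apply (p o\<^sub>L q) v = blinfun_apply p v"
    by (simp add: w_def blinfun.diff_right)
qed

section \<open>The Baire category argument\<close>

text \<open>The interface through which one argument serves both quasi-locality and approximability.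
  \<open>wot_closed\<close> concerns only sequences, since the limits to be taken run along the
  \<open>p n\<close>, and only contractions, whose approximants are then uniformly bounded.\<close>

locale op_control =
  fixes P :: "real \<Rightarrow> real \<Rightarrow> 'a op \<Rightarrow> bool"
  assumes mono: "P \<epsilon> r a \<Longrightarrow> r \<le> s \<Longrightarrow> P \<epsilon> s a"
    and add: "P \<epsilon> r a \<Longrightarrow> P \<delta> r b \<Longrightarrow> P (\<epsilon> + \<delta>) r (a + b)"
    and uminus: "P \<epsilon> r a \<Longrightarrow> P \<epsilon> r (- a)"
    and small: "norm a \<le> \<epsilon> \<Longrightarrow> 0 < r \<Longrightarrow> P \<epsilon> r a"
    and wot_closed: "(\<And>k :: nat. norm (f k) \<le> 1) \<Longrightarrow> (\<And>k. P \<epsilon> r (f k)) \<Longrightarrow>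
      wot_tendsto f l sequentially \<Longrightarrow> P \<epsilon> r l"
begin

lemma uniform_on_compact:
  assumes "compact K" "\<And>a \<epsilon>. a \<in> K \<Longrightarrow> \<epsilon> > 0 \<Longrightarrow> \<exists>r>0. P \<epsilon> r a" "\<epsilon> > 0"
  shows "\<exists>r>0. \<forall>a\<in>K. P \<epsilon> r a"
proof -
  obtain N where N: "finite N" "N \<subseteq> K" "K \<subseteq> (\<Union>x\<in>N. ball x (\<epsilon> / 2))"
  proof (rule compactE_image[OF assms(1), of K "\<lambda>x. ball x (\<epsilon> / 2)"])
    show "K \<subseteq> (\<Union>x\<in>K. ball x (\<epsilon> / 2))"
      using assms(3) by auto
  qed auto
  have "\<forall>x\<in>N. \<exists>r>0. P (\<epsilon> / 2) r x"
    using assms(2)[of _ "\<epsilon> / 2"] N(2) assms(3) by auto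
  then obtain \<rho> where \<rho>: "\<And>x. x \<in> N \<Longrightarrow> \<rho> x > 0 \<and> P (\<epsilon> / 2) (\<rho> x) x"
    by metis
  \<comment> \<open>The element 1 keeps the maximum defined and positive even for an empty
    net.\<close>
  define r where "r = Max (insert 1 (\<rho> ` N))"
  have r: "r > 0" "\<And>x. x \<in> N \<Longrightarrow> \<rho> x \<le> r"
    using N(1) by (auto simp: r_def Max_gr_iff)
  have "P \<epsilon> r a" if a: "a \<in> K" for a
  proof -
    obtain x where x: "x \<in> N" "dist x a < \<epsilon> / 2"
      using N(3) a by auto
    have "P (\<epsilon> / 2) r x"
      using \<rho>[OF x(1)] mono r(2)[OF x(1)] by blast
    moreover have "P (\<epsilon> / 2) r (a - x)"
      using x r(1)
      by (intro small) (auto simp: dist_norm norm_minus_commute)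
    ultimately show ?thesis
      using add[of "\<epsilon> / 2" r x "\<epsilon> / 2" "a - x"] by simp
  qed
  with r(1) show ?thesis by blast
qed

end

section \<open>Algebras exhausted by central projections\<close>

locale exhausted_algebra =
  fixes M :: "'a op set" and e :: "'a op" and p :: "nat \<Rightarrow> 'a op"
  assumes star_subalgebra: "star_subalgebra M"
    and closedin_wot: "closedin wot M"
    and unit: "is_unit_of e M"
    and central: "\<And>n. central_projection (p n) M"
    and increasing: "monotone (\<le>) op_le p"
    and sot_limit: "limitin sot p e sequentially"
    and fin_dim_corner: "\<And>n. fin_dim {p n o\<^sub>L a o\<^sub>L p n |a. a \<in> M}"
begin

lemma in_bounded_ops: "a \<in> M \<Longrightarrow> a \<in> bounded_ops"
  using star_subalgebra unfolding star_subalgebra_def by blast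

lemma compose_closed: "a \<in> M \<Longrightarrow> b \<in> M \<Longrightarrow> a o\<^sub>L b \<in> M"
  using star_subalgebra unfolding star_subalgebra_def by blast

lemma add_closed: "a \<in> M \<Longrightarrow> b \<in> M \<Longrightarrow> a + b \<in> M"
  and diff_closed: "a \<in> M \<Longrightarrow> b \<in> M \<Longrightarrow> a - b \<in> M"
  and zero_closed: "0 \<in> M"
  using star_subalgebra cop.subspace_add cop.subspace_diff cop.subspace_0
  unfolding star_subalgebra_def by blast+

lemma p_closed: "p n \<in> M"
  and projection_p: "projection (p n)"
  and p_commute: "a \<in> M \<Longrightarrow> blinfun_apply (p n) (blinfun_apply a v) = blinfun_apply a (blinfun_apply (p n) v)"
  using central[of n] unfolding central_projection_def
  by (auto simp flip: blinfun_apply_blinfun_compose)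

lemma apply_unit: "a \<in> M \<Longrightarrow> blinfun_apply a (blinfun_apply e v) = blinfun_apply a v"
  using unit unfolding is_unit_of_def by (metis blinfun_apply_blinfun_compose)

lemma p_absorb:
  assumes "n \<le> m"
  shows "blinfun_apply (p m) (blinfun_apply (p n) v) = blinfun_apply (p n) v"
proof -
  have "p n o\<^sub>L p m = p n"
    using increasing assms by (intro projection_op_le_imp_compose projection_p) (auto simp: monotone_def)
  then show ?thesis
    by (metis blinfun_apply_blinfun_compose p_commute[OF p_closed])
qed

lemma agree_on_smaller:
  assumes "a o\<^sub>L p m = b o\<^sub>L p m" "n \<le> m"
  shows "a o\<^sub>L p n = b o\<^sub>L p n"
  using assms(1) p_absorb[OF assms(2)] by (metis blinfun_apply_blinfun_compose blinfun_eqI)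

text \<open>Elements of \<open>M\<close> absorb \<open>e\<close>, and \<open>c m - b\<close> kills
  the range of \<open>p m\<close>, so \<open>c m - b\<close> sees of \<open>v\<close> only
  \<open>e v - p m v\<close>, which tends to 0 because \<open>p\<close> converges strongly to
  \<open>e\<close>. The norms of \<open>c m - b\<close> stay bounded.\<close>

lemma wot_tendsto_if_agree:
  assumes c: "\<And>m. c m \<in> M" "\<And>m. norm (c m) \<le> 1" and b: "b \<in> M"
    and agree: "\<And>m. c m o\<^sub>L p m = b o\<^sub>L p m"
  shows "wot_tendsto c b sequentially"
proof -
  have "(\<lambda>m. blinfun_apply (c m) v) \<longlonglongrightarrow> blinfun_apply b v" for v
  proof -
    let ?d = "\<lambda>m. blinfun_apply e v - blinfun_apply (p m) v"
    have d: "(\<lambda>m. norm (?d m)) \<longlonglongrightarrow> 0"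
      using tendsto_diff[OF tendsto_const limitin_sot_tendsto[OF sot_limit, of v], of "blinfun_apply e v"]
      by (intro tendsto_norm_zero) simp
    have bound: "norm (blinfun_apply (c m) v - blinfun_apply b v) \<le> (1 + norm b) * norm (?d m)" for m
    proof -
      have "blinfun_apply (c m) (blinfun_apply (p m) v) = blinfun_apply b (blinfun_apply (p m) v)"
        using agree[of m] by (metis blinfun_apply_blinfun_compose)
      then have "blinfun_apply (c m) v - blinfun_apply b v = blinfun_apply (c m - b) (?d m)"
        by (simp add: blinfun.diff_left blinfun.diff_right apply_unit c b)
      also have "norm \<dots> \<le> norm (c m - b) * norm (?d m)"
        by (rule norm_blinfun)
      also have "\<dots> \<le> (1 + norm b) * norm (?d m)"
        using norm_triangle_ineq4[of "c m" b] c(2)[of m] by (intro mult_right_mono) auto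
      finally show ?thesis .
    qed
    have "(\<lambda>m. (1 + norm b) * norm (?d m)) \<longlonglongrightarrow> 0"
      using tendsto_mult_left[OF d, of "1 + norm b"] by simp
    then have "(\<lambda>m. blinfun_apply (c m) v - blinfun_apply b v) \<longlonglongrightarrow> 0"
      by (rule Lim_null_comparison[OF always_eventually[OF allI[OF bound]]])
    then show ?thesis
      by (rule LIM_zero_cancel)
  qed
  then show ?thesis
    unfolding wot_tendsto_def
    by (intro allI bounded_linear.tendsto[OF bounded_linear_cinner_left])
qed

text \<open>Since \<open>p n\<close> commutes with \<open>a\<close> and \<open>b\<close>, the two
  pieces of \<open>c\<close> act on the range and on the kernel of \<open>p n\<close> separately and
  preserve them. Pythagoras then bounds the norm by 1, where the triangle inequality would only give
  2.\<close>

lemma glue: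
  fixes n
  assumes a: "a \<in> M" "norm a \<le> 1" and b: "b \<in> M" "norm b \<le> 1"
  defines "c \<equiv> (a o\<^sub>L p n) + (b - (b o\<^sub>L p n))"
  shows "c \<in> M" and "c o\<^sub>L p n = a o\<^sub>L p n" and "norm c \<le> 1"
proof -
  show "c \<in> M"
    unfolding c_def by (intro add_closed diff_closed compose_closed a b p_closed)
  note idem = projection_idem[OF projection_p]
  show "c o\<^sub>L p n = a o\<^sub>L p n"
    by (rule blinfun_eqI) (simp add: c_def blinfun.add_left blinfun.diff_left idem)
  show "norm c \<le> 1"
  proof (rule norm_blinfun_bound)
    fix v
    let ?q = "blinfun_apply (p n)"
    have cv: "blinfun_apply c v = blinfun_apply a (?q v) + blinfun_apply b (v - ?q v)"
      by (simp add: c_def blinfun.add_left blinfun.diff_left blinfun.diff_right)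
    have pc: "?q (blinfun_apply c v) = blinfun_apply a (?q v)"
      unfolding cv by (simp add: blinfun.add_right blinfun.diff_right p_commute a b idem)
    have "(norm (blinfun_apply c v))\<^sup>2 = (norm (blinfun_apply a (?q v)))\<^sup>2 + (norm (blinfun_apply b (v - ?q v)))\<^sup>2"
      using projection_Pythagoras[OF projection_p[of n], of "blinfun_apply c v"] unfolding pc
      by (simp add: cv)
    also have "\<dots> \<le> (norm (?q v))\<^sup>2 + (norm (v - ?q v))\<^sup>2"
      using norm_blinfun[of a "?q v"] norm_blinfun[of b "v - ?q v"]
        mult_right_mono[OF a(2) norm_ge_zero[of "?q v"]] mult_right_mono[OF b(2) norm_ge_zero[of "v - ?q v"]]
      by (intro add_mono power_mono) auto
    also have "\<dots> = (norm v)\<^sup>2"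
      by (rule projection_Pythagoras[OF projection_p, symmetric])
    finally show "norm (blinfun_apply c v) \<le> 1 * norm v"
      by (simp add: power2_le_iff_abs_le)
  qed simp
qed

text \<open>This is the Baire category theorem for the unit ball of \<open>M\<close> under the ultrametric in which two
  elements are close when they agree below \<open>p n\<close> for a large \<open>n\<close>. Completeness comes from weak
  operator compactness: a weak cluster point of a Cauchy sequence agrees with its terms below
  the respective \<open>p n\<close>.\<close>

lemma Baire_uniform_neighbourhood:
  assumes "op_control P" and cover: "\<And>a. a \<in> M \<Longrightarrow> \<exists>r>0. P \<epsilon> r a"
  shows "\<exists>r>0. \<exists>n. \<exists>a\<in>M. norm a \<le> 1 \<and> (\<forall>b\<in>M. norm b \<le> 1 \<longrightarrow> b o\<^sub>L p n = a o\<^sub>L p n \<longrightarrow> P \<epsilon> r b)"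
proof (rule ccontr)
  interpret op_control P by fact
  assume contra: "\<not> ?thesis"
  \<comment> \<open>By the negated claim no ultrametric ball lies in the set where \<open>P\<close>
    holds with radius \<open>r\<close>. As this set is closed, every ball contains a smaller one
    that misses it.\<close>
  have step: "\<exists>b m. b \<in> M \<and> norm b \<le> 1 \<and> n \<le> m \<and> b o\<^sub>L p n = a o\<^sub>L p n \<and>
      (\<forall>c\<in>M. norm c \<le> 1 \<longrightarrow> c o\<^sub>L p m = b o\<^sub>L p m \<longrightarrow> \<not> P \<epsilon> r c)"
    if "r > 0" and a: "a \<in> M" "norm a \<le> 1" for r n a
  proof -
    obtain b where b: "b \<in> M" "norm b \<le> 1" "b o\<^sub>L p n = a o\<^sub>L p n" "\<not> P \<epsilon> r b"
      using contra \<open>r > 0\<close> a by blast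
    have "\<exists>m\<ge>n. \<forall>c\<in>M. norm c \<le> 1 \<longrightarrow> c o\<^sub>L p m = b o\<^sub>L p m \<longrightarrow> \<not> P \<epsilon> r c"
    proof (rule ccontr)
      assume "\<not> ?thesis"
      \<comment> \<open>The shift to \<open>n + m\<close> makes every \<open>m\<close> give an
        admissible index, so that the counterexamples form a full sequence converging weakly to
        \<open>b\<close>.\<close>
      then have "\<forall>m. \<exists>c. c \<in> M \<and> norm c \<le> 1 \<and> c o\<^sub>L p (n + m) = b o\<^sub>L p (n + m) \<and> P \<epsilon> r c"
        by (meson le_add1)
      from choice[OF this] obtain c where c: "c m \<in> M" "norm (c m) \<le> 1"
        "c m o\<^sub>L p (n + m) = b o\<^sub>L p (n + m)" "P \<epsilon> r (c m)" for m
        by blast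
      have "c m o\<^sub>L p m = b o\<^sub>L p m" for m
        by (rule agree_on_smaller[OF c(3)]) simp
      then have "wot_tendsto c b sequentially"
        by (intro wot_tendsto_if_agree c b)
      then have "P \<epsilon> r b"
        by (rule wot_closed[OF c(2,4)])
      with b(4) show False ..
    qed
    with b show ?thesis by blast
  qed
  \<comment> \<open>Nested balls, coded as pairs of centre and level. The ball chosen at stage
    \<open>k\<close> avoids radius \<open>Suc k\<close>, so together they avoid arbitrarily large
    radii.\<close>
  have "\<exists>s :: nat \<Rightarrow> 'a op \<times> nat. \<forall>k. (fst (s k) \<in> M \<and> norm (fst (s k)) \<le> 1) \<and>
    (snd (s k) \<le> snd (s (Suc k)) \<and> fst (s (Suc k)) o\<^sub>L p (snd (s k)) = fst (s k) o\<^sub>L p (snd (s k)) \<and>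
     (\<forall>c\<in>M. norm c \<le> 1 \<longrightarrow> c o\<^sub>L p (snd (s (Suc k))) = fst (s (Suc k)) o\<^sub>L p (snd (s (Suc k)))
        \<longrightarrow> \<not> P \<epsilon> (real (Suc k)) c))"
    (is "\<exists>s. \<forall>k. ?I (s k) \<and> ?Q k (s k) (s (Suc k))")
  proof (rule dependent_nat_choice)
    show "\<exists>x. ?I x"
      by (rule exI[of _ "(0, 0)"]) (simp add: zero_closed)
    fix x k
    assume "?I x"
    then show "\<exists>y. ?I y \<and> ?Q k x y"
      using step[of "real (Suc k)" "fst x" "snd x"] by auto
  qed
  then obtain s where s: "\<And>k. ?I (s k)" "\<And>k. ?Q k (s k) (s (Suc k))"
    by blast
  define b where "b = (\<lambda>k. fst (s k))"
  define m where "m = (\<lambda>k. snd (s k))"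
  have b: "b k \<in> M" "norm (b k) \<le> 1" and mono_step: "m k \<le> m (Suc k)"
    and agree_step: "b (Suc k) o\<^sub>L p (m k) = b k o\<^sub>L p (m k)"
    and avoid: "\<And>c. c \<in> M \<Longrightarrow> norm c \<le> 1 \<Longrightarrow> c o\<^sub>L p (m (Suc k)) = b (Suc k) o\<^sub>L p (m (Suc k))
      \<Longrightarrow> \<not> P \<epsilon> (real (Suc k)) c" for k
    using s(1)[of k] s(2)[of k] by (auto simp: b_def m_def)
  have agree: "b l o\<^sub>L p (m k) = b k o\<^sub>L p (m k)" if "k \<le> l" for k l
    using that
  proof (induction l rule: dec_induct)
    case (step l)
    have "m k \<le> m l"
      using lift_Suc_mono_le[of m, OF mono_step step.hyps(1)] .
    from agree_on_smaller[OF agree_step this] step.IH show ?case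
      by simp
  qed simp
  obtain G a where G: "G \<le> sequentially" "G \<noteq> bot" and a: "a \<in> bounded_ops" "wot_tendsto b a G"
    using wot_cluster_point[of sequentially b 1] b in_bounded_ops by (metis trivial_limit_sequentially)
  have aM: "a \<in> M"
    by (rule closedin_wot_limit[OF closedin_wot a(2) G(2) b(1) a(1)])
  have na: "norm a \<le> 1"
    by (rule norm_le_wot_limit[OF a(2) G(2)]) (simp add: b)
  have "a o\<^sub>L p (m k) = b k o\<^sub>L p (m k)" for k
  proof (intro blinfun_eqI ell2_eqI)
    fix v x
    let ?u = "blinfun_apply (p (m k)) v"
    \<comment> \<open>Below \<open>p (m k)\<close> the sequence is constant from index
      \<open>k\<close> on, so its weak cluster point takes the same value there; pairing with
      \<open>delta x\<close> reads off coordinates.\<close>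
    have "\<forall>\<^sub>F l in G. k \<le> l"
      using filter_leD[OF G(1)] eventually_ge_at_top by blast
    then have "\<forall>\<^sub>F l in G. cinner (blinfun_apply (b l) ?u) (delta x) = cinner (blinfun_apply (b k) ?u) (delta x)"
      by eventually_elim (use agree in \<open>metis blinfun_apply_blinfun_compose\<close>)
    from tendsto_eventually[OF this] wot_tendstoD[OF a(2)]
    have "cinner (blinfun_apply a ?u) (delta x) = cinner (blinfun_apply (b k) ?u) (delta x)"
      using tendsto_unique[OF G(2)] by blast
    then show "ell2_apply (blinfun_apply (a o\<^sub>L p (m k)) v) x = ell2_apply (blinfun_apply (b k o\<^sub>L p (m k)) v) x"
      by (simp add: cinner_delta_right)
  qed
  then have never: "\<not> P \<epsilon> (real (Suc k)) a" for k
    using avoid[OF aM na] by blast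
  obtain r where "P \<epsilon> r a"
    using cover[OF aM] by blast
  \<comment> \<open>Monotonicity in the radius lifts the real \<open>r\<close> to an integer radius
    that was excluded.\<close>
  then show False
    using never[of "nat \<lceil>r\<rceil>"] mono[of \<epsilon> r a "real (Suc (nat \<lceil>r\<rceil>))"] by linarith
qed

lemma uniform_on_corner:
  assumes "op_control P" and pointwise: "\<And>a \<epsilon>. a \<in> M \<Longrightarrow> \<epsilon> > 0 \<Longrightarrow> \<exists>r>0. P \<epsilon> r a" and "\<epsilon> > 0"
  shows "\<exists>r>0. \<forall>a\<in>M. norm a \<le> 1 \<longrightarrow> P \<epsilon> r (p n o\<^sub>L a o\<^sub>L p n)"
proof -
  let ?N = "{p n o\<^sub>L a o\<^sub>L p n |a. a \<in> M}"
  have NM: "?N \<subseteq> M"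
    using compose_closed p_closed by blast
  have "compact (?N \<inter> cball 0 1)"
    using fin_dim_corner[of n] compact_span_Int_cball unfolding fin_dim_def by metis
  then have "\<exists>r>0. \<forall>a\<in>?N \<inter> cball 0 1. P \<epsilon> r a"
    using NM pointwise
    by (intro op_control.uniform_on_compact[OF assms(1) _ _ \<open>\<epsilon> > 0\<close>]) blast+
  moreover have "norm (p n o\<^sub>L a o\<^sub>L p n) \<le> 1" if "norm a \<le> 1" for a
    using norm_contraction_compose_le[of "p n" "p n" a] norm_projection_le_1[OF projection_p[of n]] that
    by simp
  ultimately show ?thesis by fastforce
qed

lemma uniform_on_unit_ball:
  assumes "op_control P" and pointwise: "\<And>a \<epsilon>. a \<in> M \<Longrightarrow> \<epsilon> > 0 \<Longrightarrow> \<exists>r>0. P \<epsilon> r a" and "\<epsilon> > 0"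
  shows "\<exists>r>0. \<forall>a\<in>M. norm a \<le> 1 \<longrightarrow> P \<epsilon> r a"
proof -
  interpret op_control P by fact
  have \<epsilon>3: "\<epsilon> / 3 > 0" using \<open>\<epsilon> > 0\<close> by simp
  obtain r0 n a0 where r0: "r0 > 0" and a0: "a0 \<in> M" "norm a0 \<le> 1"
    and nbhd: "\<And>b. b \<in> M \<Longrightarrow> norm b \<le> 1 \<Longrightarrow> b o\<^sub>L p n = a0 o\<^sub>L p n \<Longrightarrow> P (\<epsilon> / 3) r0 b"
    using Baire_uniform_neighbourhood[OF assms(1) pointwise[OF _ \<epsilon>3]] by blast
  obtain r1 where r1: "P (\<epsilon> / 3) r1 (a0 o\<^sub>L p n)"
    using pointwise[OF compose_closed[OF a0(1) p_closed] \<epsilon>3] by blast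
  obtain r2 where r2: "\<And>a. a \<in> M \<Longrightarrow> norm a \<le> 1 \<Longrightarrow> P (\<epsilon> / 3) r2 (p n o\<^sub>L a o\<^sub>L p n)"
    using uniform_on_corner[OF assms(1) pointwise \<epsilon>3] by blast
  define r where "r = max r0 (max r1 r2)"
  have "P \<epsilon> r a" if a: "a \<in> M" "norm a \<le> 1" for a
  proof -
    define b where "b = (a0 o\<^sub>L p n) + (a - (a o\<^sub>L p n))"
    have "P (\<epsilon> / 3) r0 b"
      unfolding b_def by (intro nbhd glue a0 a)
    then have "P (\<epsilon> / 3 + \<epsilon> / 3 + \<epsilon> / 3) r (b + - (a0 o\<^sub>L p n) + (p n o\<^sub>L a o\<^sub>L p n))"
      using r1 r2[OF a] by (intro add uminus) (auto intro: mono simp: r_def)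
    \<comment> \<open>Centrality reduces the corner term to \<open>a p n\<close>, which is exactly
      what \<open>b\<close> lacks after \<open>a0 p n\<close> is removed.\<close>
    moreover have "p n o\<^sub>L a o\<^sub>L p n = a o\<^sub>L p n"
      by (rule blinfun_eqI) (simp add: p_commute a projection_idem[OF projection_p])
    ultimately show ?thesis
      by (simp add: b_def)
  qed
  moreover have "r > 0" using r0 by (simp add: r_def)
  ultimately show ?thesis by blast
qed

end

section \<open>Quasi-local and approximable operators\<close>

lemma cinner_chi: "cinner (blinfun_apply (chi A) v) w = cinner v (blinfun_apply (chi A) w)"
  unfolding cinner_def by (rule infsum_cong) (simp add: chi_apply)

lemma norm_chi_le_1: "norm (chi A) \<le> 1"
proof (rule norm_projection_le_1)
  have "adj (chi A) = chi A"
  proof (intro blinfun_eqI ell2_eqI)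
    fix v x
    have "chi A \<in> bounded_ops"
      by (auto intro!: ell2_eqI simp: bounded_ops_def chi_apply)
    then show "ell2_apply (blinfun_apply (adj (chi A)) v) x = ell2_apply (blinfun_apply (chi A) v) x"
      using adj_works[of "chi A" "delta x" v] cinner_chi[of A "delta x" v]
      by (metis cinner_commute cinner_delta_right)
  qed
  then show "projection (chi A)"
    by (auto intro!: ell2_eqI blinfun_eqI simp: projection_def bounded_ops_def chi_apply)
qed

lemma chi_compose_add: "chi A o\<^sub>L (a + b) o\<^sub>L chi B = (chi A o\<^sub>L a o\<^sub>L chi B) + (chi A o\<^sub>L b o\<^sub>L chi B)"
  and chi_compose_minus: "chi A o\<^sub>L (- a) o\<^sub>L chi B = - (chi A o\<^sub>L a o\<^sub>L chi B)"
  by (auto intro!: blinfun_eqI simp: blinfun.add_left blinfun.add_right blinfun.minus_left blinfun.minus_right)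

text \<open>For weak closedness, \<open>chi A\<close> moves to the other side of the inner product,
  so compression to \<open>A\<close> and \<open>B\<close> preserves weak limits; the norm bound then
  passes to the limit by lower semicontinuity.\<close>

lemma op_control_quasi_local: "op_control quasi_local"
proof
  fix \<epsilon> r s \<delta> :: real and a b :: "'a op"
  show "quasi_local \<epsilon> r a \<Longrightarrow> r \<le> s \<Longrightarrow> quasi_local \<epsilon> s a"
    unfolding quasi_local_def by (meson le_less_trans)
  show "quasi_local (\<epsilon> + \<delta>) r (a + b)" if "quasi_local \<epsilon> r a" "quasi_local \<delta> r b"
    using that unfolding quasi_local_def chi_compose_add by (meson norm_triangle_mono)
  show "quasi_local \<epsilon> r a \<Longrightarrow> quasi_local \<epsilon> r (- a)"
    unfolding quasi_local_def chi_compose_minus by simp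
  show "norm a \<le> \<epsilon> \<Longrightarrow> quasi_local \<epsilon> r a"
    unfolding quasi_local_def
    using norm_contraction_compose_le[OF norm_chi_le_1 norm_chi_le_1] order_trans by blast
next
  fix \<epsilon> r and f :: "nat \<Rightarrow> 'a op" and l
  assume f: "\<And>k. quasi_local \<epsilon> r (f k)" and lim: "wot_tendsto f l sequentially"
  have "norm (chi A o\<^sub>L l o\<^sub>L chi B) \<le> \<epsilon>" if "setdist A B > r" for A B
  proof (rule norm_le_wot_limit)
    show "wot_tendsto (\<lambda>k. chi A o\<^sub>L f k o\<^sub>L chi B) (chi A o\<^sub>L l o\<^sub>L chi B) sequentially"
      using lim by (simp add: wot_tendsto_def cinner_chi)
    show "\<forall>\<^sub>F k in sequentially. norm (chi A o\<^sub>L f k o\<^sub>L chi B) \<le> \<epsilon>"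
      using f that by (simp add: quasi_local_def)
  qed simp
  then show "quasi_local \<epsilon> r l"
    by (simp add: quasi_local_def)
qed

section \<open>Approximation by operators of finite propagation\<close>

lemma propagation_le_iff:
  assumes "0 \<le> r"
  shows "propagation a \<le> ennreal r \<longleftrightarrow>
    (\<forall>x z. cinner (blinfun_apply a (delta x)) (delta z) \<noteq> 0 \<longrightarrow> dist x z \<le> r)"
  unfolding propagation_def Sup_le_iff ennreal_le_iff[OF assms, symmetric] by blast

lemma bounded_ops_add: "a \<in> bounded_ops \<Longrightarrow> b \<in> bounded_ops \<Longrightarrow> a + b \<in> bounded_ops"
  and bounded_ops_uminus: "a \<in> bounded_ops \<Longrightarrow> - a \<in> bounded_ops"
  by (auto intro!: ell2_eqI simp: bounded_ops_def blinfun.add_left blinfun.minus_left algebra_simps)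

text \<open>The conjunct \<open>0 < r\<close> is needed because \<open>ennreal r = 0\<close> for negative \<open>r\<close>, so that
  \<open>propagation b \<le> ennreal r\<close> says \<open>dist x z \<le> r\<close> on the support of \<open>b\<close> only if \<open>r \<ge> 0\<close>.\<close>

lemma op_control_approximable: "op_control (\<lambda>\<epsilon> r a. 0 < r \<and> approximable \<epsilon> r a)"
proof
  fix \<epsilon> r s :: real and a :: "'a op"
  assume a: "0 < r \<and> approximable \<epsilon> r a" and "r \<le> s"
  then have "ennreal r \<le> ennreal s"
    by (simp add: ennreal_leI)
  with a \<open>r \<le> s\<close> show "0 < s \<and> approximable \<epsilon> s a"
    unfolding approximable_def by (meson less_le_trans order_trans)
next
  fix \<epsilon> r \<delta> :: real and a b :: "'a op"
  assume "0 < r \<and> approximable \<epsilon> r a" "0 < r \<and> approximable \<delta> r b"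
  then obtain c d where r: "0 < r" and c: "c \<in> bounded_ops" "propagation c \<le> ennreal r" "norm (a - c) \<le> \<epsilon>"
    and d: "d \<in> bounded_ops" "propagation d \<le> ennreal r" "norm (b - d) \<le> \<delta>"
    unfolding approximable_def by blast
  have "propagation (c + d) \<le> ennreal r"
    using c(2) d(2) r by (auto simp: propagation_le_iff blinfun.add_left cinner_add_left) (metis add.right_neutral)
  moreover have "norm (a + b - (c + d)) \<le> \<epsilon> + \<delta>"
    using norm_triangle_mono[OF c(3) d(3)] by (simp add: algebra_simps)
  ultimately show "0 < r \<and> approximable (\<epsilon> + \<delta>) r (a + b)"
    unfolding approximable_def using r bounded_ops_add[OF c(1) d(1)] by blast
next
  fix \<epsilon> r :: real and a :: "'a op"
  assume "0 < r \<and> approximable \<epsilon> r a"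
  then obtain c where r: "0 < r" and c: "c \<in> bounded_ops" "propagation c \<le> ennreal r" "norm (a - c) \<le> \<epsilon>"
    unfolding approximable_def by blast
  have "propagation (- c) \<le> ennreal r"
    using c(2) r by (simp add: propagation_le_iff cinner_delta_right blinfun.minus_left)
  moreover have "norm (- a - - c) \<le> \<epsilon>"
    using c(3) by (simp add: norm_minus_commute)
  ultimately show "0 < r \<and> approximable \<epsilon> r (- a)"
    unfolding approximable_def using r bounded_ops_uminus[OF c(1)] by blast
next
  fix \<epsilon> r :: real and a :: "'a op"
  assume "norm a \<le> \<epsilon>" "0 < r"
  moreover have "0 \<in> bounded_ops" "propagation 0 \<le> ennreal r"
    using \<open>0 < r\<close> by (auto intro!: ell2_eqI simp: bounded_ops_def propagation_le_iff cinner_delta_right)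
  ultimately show "0 < r \<and> approximable \<epsilon> r a"
    unfolding approximable_def by (intro conjI bexI[of _ 0]) auto
next
  fix \<epsilon> r and f :: "nat \<Rightarrow> 'a op" and l
  assume ops: "\<And>k. norm (f k) \<le> 1"
    and f: "\<And>k. 0 < r \<and> approximable \<epsilon> r (f k)"
    and lim: "wot_tendsto f l sequentially"
  from f have r: "0 < r" by blast
  have "\<forall>k. \<exists>b. b \<in> bounded_ops \<and> propagation b \<le> ennreal r \<and> norm (f k - b) \<le> \<epsilon>"
    using f unfolding approximable_def by blast
  from choice[OF this] obtain b where b: "b k \<in> bounded_ops" "propagation (b k) \<le> ennreal r"
    "norm (f k - b k) \<le> \<epsilon>" for k
    by blast
  \<comment> \<open>A uniform bound on the approximants is what weak compactness requires.\<close>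
  have "norm (b k) \<le> 1 + \<epsilon>" for k
    using norm_triangle_mono[OF ops[of k] b(3)[of k, unfolded norm_minus_commute[of "f k"]]] by simp
  then obtain G c where G: "G \<le> sequentially" "G \<noteq> bot" and c: "c \<in> bounded_ops" "wot_tendsto b c G"
    by (rule wot_cluster_point[OF trivial_limit_sequentially b(1)])
  have "norm (l - c) \<le> \<epsilon>"
    by (rule norm_le_wot_limit[OF wot_tendsto_diff[OF wot_tendsto_mono[OF lim G(1)] c(2)] G(2)])
      (simp add: b)
  moreover have "propagation c \<le> ennreal r"
    unfolding propagation_le_iff[OF less_imp_le[OF r]]
  proof (intro allI impI, rule ccontr)
    fix x z
    assume nz: "cinner (blinfun_apply c (delta x)) (delta z) \<noteq> 0" and "\<not> dist x z \<le> r"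
    \<comment> \<open>Matrix entries at distance beyond \<open>r\<close> vanish for every
      approximant, hence also for their weak limit.\<close>
    then have "cinner (blinfun_apply (b k) (delta x)) (delta z) = 0" for k
      using b(2)[of k] r by (auto simp: propagation_le_iff)
    then have "((\<lambda>k. 0) \<longlongrightarrow> cinner (blinfun_apply c (delta x)) (delta z)) G"
      using wot_tendstoD[OF c(2), of "delta x" "delta z"] by simp
    from tendsto_unique[OF G(2) this tendsto_const] nz show False
      by simp
  qed
  ultimately show "0 < r \<and> approximable \<epsilon> r l"
    unfolding approximable_def using r c(1) by blast
qed

lemma uniform_roe_approximable:
  assumes "a \<in> uniform_roe" "\<epsilon> > 0"
  shows "\<exists>r>0. approximable \<epsilon> r a"
proof -
  obtain b where b: "b \<in> bounded_ops" "propagation b < \<infinity>" "dist b a < \<epsilon>"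
    using assms unfolding uniform_roe_def closure_approachable by blast
  obtain r where r: "0 \<le> r" "propagation b = ennreal r"
    using b(2) by (cases "propagation b") auto
  \<comment> \<open>The propagation may be 0, whereas the radius has to be positive.\<close>
  have "approximable \<epsilon> (r + 1) a"
    unfolding approximable_def using b r
    by (intro bexI[of _ b]) (auto simp: dist_norm norm_minus_commute ennreal_leI)
  with r(1) show ?thesis
    by (intro exI[of _ "r + 1"]) simp
qed

theorem lemma1p11:
  fixes M :: "'a::metric_space op set" and e :: "'a op" and p :: "nat \<Rightarrow> 'a op"
  assumes "star_subalgebra M"
    and "closedin wot M"
    and "is_unit_of e M"
    and "\<And>n. central_projection (p n) M"
    and "monotone (\<le>) op_le p"
    and "limitin sot p e sequentially"
    and "\<And>n. fin_dim {p n o\<^sub>L a o\<^sub>L p n |a. a \<in> M}"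
  shows "(M \<subseteq> quasi_local_algebra \<longrightarrow> equi_quasi_local {a \<in> M. norm a \<le> 1})
       \<and> (M \<subseteq> uniform_roe \<longrightarrow> equi_approximable {a \<in> M. norm a \<le> 1})"
proof (intro conjI impI)
  interpret exhausted_algebra M e p
    by (rule exhausted_algebra.intro[OF assms])
  show "equi_quasi_local {a \<in> M. norm a \<le> 1}" if M: "M \<subseteq> quasi_local_algebra"
  proof -
    have pointwise: "\<exists>r>0. quasi_local \<epsilon> r a" if "a \<in> M" "\<epsilon> > 0" for a \<epsilon>
      using M that by (auto simp: quasi_local_algebra_def)
    show ?thesis
      unfolding equi_quasi_local_def
    proof (intro allI impI)
      fix \<epsilon> :: real
      assume "\<epsilon> > 0"
      from uniform_on_unit_ball[OF op_control_quasi_local pointwise this]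
      obtain r where "r > 0" "\<forall>a\<in>M. norm a \<le> 1 \<longrightarrow> quasi_local \<epsilon> r a"
        by blast
      then show "\<exists>r>0. \<forall>a\<in>{a \<in> M. norm a \<le> 1}. norm a \<le> 1 \<longrightarrow> quasi_local \<epsilon> r a"
        by (intro exI[of _ r]) simp
    qed
  qed
  show "equi_approximable {a \<in> M. norm a \<le> 1}" if M: "M \<subseteq> uniform_roe"
  proof -
    \<comment> \<open>The repeated \<open>0 < r\<close> fits the predicate of
      \<open>op_control_approximable\<close>.\<close>
    have pointwise: "\<exists>r>0. 0 < r \<and> approximable \<epsilon> r a" if "a \<in> M" "\<epsilon> > 0" for a \<epsilon>
      using uniform_roe_approximable[of a \<epsilon>] M that by auto
    show ?thesis
      unfolding equi_approximable_def
    proof (intro allI impI)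
      fix \<epsilon> :: real
      assume "\<epsilon> > 0"
      from uniform_on_unit_ball[OF op_control_approximable pointwise this]
      obtain r where "r > 0" "\<forall>a\<in>M. norm a \<le> 1 \<longrightarrow> 0 < r \<and> approximable \<epsilon> r a"
        by blast
      then show "\<exists>r>0. \<forall>a\<in>{a \<in> M. norm a \<le> 1}. norm a \<le> 1 \<longrightarrow> approximable \<epsilon> r a"
        by (intro exI[of _ r]) simp
    qed
  qed
qed

end
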